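(* Let $n\ge 1$ and let $\lambda$ be a partition with at most $n$ nonzero parts. The map $$\Omega:=\psi_{\mathrm{inv}}^{-1}\circ\psi_{\mathrm{quinv}}=\psi_{\mathrm{inv}}^{-1}\circ\mathrm{boxcomp}\circ\psi_{\mathrm{inv}}:\ \mathrm{CSF}(\lambda)\to\mathrm{CSF}(\lambda)$$ is an involution satisfying $\mathrm{inv}(\Omega(F))=\mathrm{quinv}(F)$ for all $F\in\mathrm{CSF}(\lambda)$. Further, $\mathrm{rsort}(F)=\mathrm{rsort}(\Omega(F))$ for all $F\in\mathrm{CSF}(\lambda)$.
   Context: The Young diagram of $\lambda$ is $\mathrm{dg}(\lambda)=\{(r,c):1\le c\le\lambda_r\}$, with $r$ the row index from the top and $c$ the column index from the left. $\mathrm{CSF}(\lambda)$ is the set of column strict fillings: maps $F:\mathrm{dg}(\lambda)\to[n]=\{1,\dots,n\}$ strictly increasing down each column. Statistics. For a cell $u=(i,j)$ with $i>1$ let $u^\uparrow=(i-1,j)$; $\mathrm{Des}(F)$ is the set of cells $u$ not in the first row with $F(u)>F(u^\uparrow)$; $\mathrm{arm}(u)$ is the number of cells of $\mathrm{dg}(\lambda)$ strictly to the right of $u$ in its row. A cell $u$ Inv-attacks $v$ if they are in the same row with $u$ strictly left of $v$, or $u$ is in the row immediately below that of $v$, in a column strictly to the right of that of $v$. A cell $u$ Quinv-attacks $v$ if they are in the same row with $u$ strictly right of $v$, or $u$ is in the row immediately below that of $v$, in a column strictly to the left of that of $v$. $\mathrm{Inv}(F)$ (resp. $\mathrm{Quinv}(F)$)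 is the set of pairs $(u,v)$ such that $u$ Inv-attacks (resp. Quinv-attacks) $v$ and $F(u)>F(v)$. Then $\mathrm{inv}(F)=|\mathrm{Inv}(F)|-\sum_{u\in\mathrm{Des}(F)}\mathrm{arm}(u)$ and $\mathrm{quinv}(F)=|\mathrm{Quinv}(F)|-\sum_{u\in\mathrm{Des}(F)}\mathrm{arm}(u^\uparrow)$. Patterns. $\mathrm{GT}(\lambda)$ is the set of integer arrays $T=(T^j_i:1\le i\le j\le n)$ with $T^n_i=\lambda_i$ and, for $1\le i\le j<n$, $\mathrm{NE}_{ij}(T):=T^{j+1}_i-T^j_i\ge0$ and $\mathrm{SE}_{ij}(T):=T^j_i-T^{j+1}_{i+1}\ge0$; it is identified with semistandard Young tableaux of shape $\lambda$ with entries in $[n]$ by letting $T^j_i$ be the number of cells in row $i$ with entries $\le j$. $\mathrm{rsort}(F)$ is obtained from $F$ by sorting the entries of each row in ascending order from left to right; it is a semistandard tableau, regarded as an element of $\mathrm{GT}(\lambda)$. $\mathrm{POP}(\lambda)$ is the set of pairs $(T,\Lambda)$ with $T\in\mathrm{GT}(\lambda)$ and $\Lambda=(\Lambda_{ij}:1\le i\le j<n)$ a tuple of partitions, $\Lambda_{ij}$ having at most $\mathrm{NE}_{ij}(T)$ nonzero parts, each $\le\mathrm{SE}_{ij}(T)$. $\mathrm{boxcomp}(T,\Lambda)=(T,\Lambda^c)$, where $(\Lambda^c)_{ij}$ is the complement of $\Lambda_{ij}$ in its $k\times\ell=\mathrm{NE}_{ij}(T)\times\mathrm{SE}_{ij}(T)$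 rectangle; the complement of $(\pi_1\ge\dots\ge\pi_k\ge0)$ is $(\ell-\pi_k\ge\dots\ge\ell-\pi_1)$. The maps $\psi_v$. For $F\in\mathrm{CSF}(\lambda)$ and a cell $c\in\mathrm{dg}(\lambda)$, let $\mathrm{zcount}(c,F)$ (resp. $\overline{\mathrm{zcount}}(c,F)$) be the number of cells $x$ in the row of $c$, strictly to the left (resp. strictly to the right) of $c$, such that $F(x)<F(c)<F(y)$, where $y$ is the position immediately below $x$ and $F(y):=\infty$ if $y\notin\mathrm{dg}(\lambda)$. For $1\le i\le j<n$ let $\mathrm{cells}(i,j,F)$ be the set of cells $c$ in row $i$ with $F(c)=j+1$. Put $T=\mathrm{rsort}(F)$. Let $\Lambda_{ij}$ be the sequence of $\mathrm{zcount}(c,F)$, $c\in\mathrm{cells}(i,j,F)$, read from right to left in row $i$, and $\overline\Lambda_{ij}$ the sequence of $\overline{\mathrm{zcount}}(c,F)$, $c\in\mathrm{cells}(i,j,F)$, read from left to right. These are partitions fitting in the $\mathrm{NE}_{ij}(T)\times\mathrm{SE}_{ij}(T)$ rectangle, and one defines $\psi_{\mathrm{quinv}}(F)=(T,(\Lambda_{ij}))$ and $\psi_{\mathrm{inv}}(F)=(T,(\overline\Lambda_{ij}))$. Both are bijections $\mathrm{CSF}(\lambda)\to\mathrm{POP}(\lambda)$. *)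

theory Defs
  imports Main "HOL-Library.FuncSet"
begin

text \<open>
  A partition is a function \<open>lam :: nat \<Rightarrow> nat\<close>, where \<open>lam r\<close> is the \<open>r\<close>-th part for \<open>r \<ge> 1\<close>
  and the value at \<open>0\<close> is never used. Cells are pairs (row, column), both counted from \<open>1\<close>.
  Fillings, patterns and tuples of partitions are extensional functions on their index sets,
  so that equality of functions is equality of the objects they represent.
\<close>

definition dg :: "(nat \<Rightarrow> nat) \<Rightarrow> (nat \<times> nat) set" where
  "dg lam = {(r, c). 1 \<le> r \<and> 1 \<le> c \<and> c \<le> lam r}"

definition CSF :: "nat \<Rightarrow> (nat \<Rightarrow> nat) \<Rightarrow> (nat \<times> nat \<Rightarrow> nat) set" where
  "CSF n lam = {F \<in> dg lam \<rightarrow>\<^sub>E {1..n}.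
     \<forall>r c. (r, c) \<in> dg lam \<longrightarrow> (Suc r, c) \<in> dg lam \<longrightarrow> F (r, c) < F (Suc r, c)}"

definition up :: "nat \<times> nat \<Rightarrow> nat \<times> nat" where
  "up u = (fst u - 1, snd u)"

definition down :: "nat \<times> nat \<Rightarrow> nat \<times> nat" where
  "down u = (fst u + 1, snd u)"

definition Des :: "(nat \<Rightarrow> nat) \<Rightarrow> (nat \<times> nat \<Rightarrow> nat) \<Rightarrow> (nat \<times> nat) set" where
  "Des lam F = {u \<in> dg lam. fst u > 1 \<and> F u > F (up u)}"

definition arm :: "(nat \<Rightarrow> nat) \<Rightarrow> nat \<times> nat \<Rightarrow> nat" where
  "arm lam u = card {v \<in> dg lam. fst v = fst u \<and> snd v > snd u}"

definition inv_attacks :: "nat \<times> nat \<Rightarrow> nat \<times> nat \<Rightarrow> bool" where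
  "inv_attacks u v \<longleftrightarrow>
     (fst u = fst v \<and> snd u < snd v) \<or> (fst u = fst v + 1 \<and> snd u > snd v)"

definition quinv_attacks :: "nat \<times> nat \<Rightarrow> nat \<times> nat \<Rightarrow> bool" where
  "quinv_attacks u v \<longleftrightarrow>
     (fst u = fst v \<and> snd u > snd v) \<or> (fst u = fst v + 1 \<and> snd u < snd v)"

definition Inv :: "(nat \<Rightarrow> nat) \<Rightarrow> (nat \<times> nat \<Rightarrow> nat) \<Rightarrow> ((nat \<times> nat) \<times> (nat \<times> nat)) set" where
  "Inv lam F = {(u, v) \<in> dg lam \<times> dg lam. inv_attacks u v \<and> F u > F v}"

definition Quinv :: "(nat \<Rightarrow> nat) \<Rightarrow> (nat \<times> nat \<Rightarrow> nat) \<Rightarrow> ((nat \<times> nat) \<times> (nat \<times> nat)) set" where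
  "Quinv lam F = {(u, v) \<in> dg lam \<times> dg lam. quinv_attacks u v \<and> F u > F v}"

definition inv_stat :: "(nat \<Rightarrow> nat) \<Rightarrow> (nat \<times> nat \<Rightarrow> nat) \<Rightarrow> int" where
  "inv_stat lam F = int (card (Inv lam F)) - (\<Sum>u\<in>Des lam F. int (arm lam u))"

definition quinv_stat :: "(nat \<Rightarrow> nat) \<Rightarrow> (nat \<times> nat \<Rightarrow> nat) \<Rightarrow> int" where
  "quinv_stat lam F = int (card (Quinv lam F)) - (\<Sum>u\<in>Des lam F. int (arm lam (up u)))"

text \<open>A pattern is stored with the row index first: \<open>T (i, j)\<close> is the entry $T^j_i$.\<close>

definition NE :: "(nat \<times> nat \<Rightarrow> int) \<Rightarrow> nat \<Rightarrow> nat \<Rightarrow> int" where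
  "NE T i j = T (i, j + 1) - T (i, j)"

definition SE :: "(nat \<times> nat \<Rightarrow> int) \<Rightarrow> nat \<Rightarrow> nat \<Rightarrow> int" where
  "SE T i j = T (i, j) - T (i + 1, j + 1)"

definition GT :: "nat \<Rightarrow> (nat \<Rightarrow> nat) \<Rightarrow> (nat \<times> nat \<Rightarrow> int) set" where
  "GT n lam = {T \<in> {(i, j). 1 \<le> i \<and> i \<le> j \<and> j \<le> n} \<rightarrow>\<^sub>E UNIV.
     (\<forall>i. 1 \<le> i \<and> i \<le> n \<longrightarrow> T (i, n) = int (lam i)) \<and>
     (\<forall>i j. 1 \<le> i \<and> i \<le> j \<and> j < n \<longrightarrow> NE T i j \<ge> 0 \<and> SE T i j \<ge> 0)}"

text \<open>
  A partition with at most \<open>k\<close> nonzero parts is written, padded with zeros, as a weakly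
  decreasing list of length exactly \<open>k\<close>. On patterns, \<open>NE\<close> and \<open>SE\<close> are nonnegative, so the
  conversions by \<open>nat\<close> below lose nothing, and complements are only taken inside the box, where
  the subtraction of naturals does not truncate.
\<close>

definition box_partitions :: "nat \<Rightarrow> nat \<Rightarrow> nat list set" where
  "box_partitions k l = {p. length p = k \<and> sorted_wrt (\<ge>) p \<and> (\<forall>x\<in>set p. x \<le> l)}"

definition box_complement :: "nat \<Rightarrow> nat list \<Rightarrow> nat list" where
  "box_complement l p = map (\<lambda>x. l - x) (rev p)"

definition POP ::
  "nat \<Rightarrow> (nat \<Rightarrow> nat) \<Rightarrow> ((nat \<times> nat \<Rightarrow> int) \<times> (nat \<times> nat \<Rightarrow> nat list)) set" where
  "POP n lam = {(T, L). T \<in> GT n lam \<and>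
     L \<in> (\<Pi>\<^sub>E (i, j)\<in>{(i, j). 1 \<le> i \<and> i \<le> j \<and> j < n}.
            box_partitions (nat (NE T i j)) (nat (SE T i j)))}"

definition boxcomp ::
  "nat \<Rightarrow> (nat \<times> nat \<Rightarrow> int) \<times> (nat \<times> nat \<Rightarrow> nat list)
       \<Rightarrow> (nat \<times> nat \<Rightarrow> int) \<times> (nat \<times> nat \<Rightarrow> nat list)" where
  "boxcomp n = (\<lambda>(T, L). (T,
     \<lambda>(i, j)\<in>{(i, j). 1 \<le> i \<and> i \<le> j \<and> j < n}. box_complement (nat (SE T i j)) (L (i, j))))"

definition row_entries :: "(nat \<Rightarrow> nat) \<Rightarrow> (nat \<times> nat \<Rightarrow> nat) \<Rightarrow> nat \<Rightarrow> nat list" where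
  "row_entries lam F r = map (\<lambda>c. F (r, c)) [1..<lam r + 1]"

definition rsort :: "(nat \<Rightarrow> nat) \<Rightarrow> (nat \<times> nat \<Rightarrow> nat) \<Rightarrow> (nat \<times> nat \<Rightarrow> nat)" where
  "rsort lam F = (\<lambda>(r, c)\<in>dg lam. sort (row_entries lam F r) ! (c - 1))"

definition pattern_of :: "nat \<Rightarrow> (nat \<Rightarrow> nat) \<Rightarrow> (nat \<times> nat \<Rightarrow> nat) \<Rightarrow> (nat \<times> nat \<Rightarrow> int)" where
  "pattern_of n lam S = (\<lambda>(i, j)\<in>{(i, j). 1 \<le> i \<and> i \<le> j \<and> j \<le> n}.
     int (card {u \<in> dg lam. fst u = i \<and> S u \<le> j}))"

text \<open>The convention that the entry below a bottom cell is infinite becomes a disjunction.\<close>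

definition zcount :: "(nat \<Rightarrow> nat) \<Rightarrow> nat \<times> nat \<Rightarrow> (nat \<times> nat \<Rightarrow> nat) \<Rightarrow> nat" where
  "zcount lam u F = card {x \<in> dg lam. fst x = fst u \<and> snd x < snd u \<and>
     F x < F u \<and> (down x \<notin> dg lam \<or> F u < F (down x))}"

definition zcount_bar :: "(nat \<Rightarrow> nat) \<Rightarrow> nat \<times> nat \<Rightarrow> (nat \<times> nat \<Rightarrow> nat) \<Rightarrow> nat" where
  "zcount_bar lam u F = card {x \<in> dg lam. fst x = fst u \<and> snd x > snd u \<and>
     F x < F u \<and> (down x \<notin> dg lam \<or> F u < F (down x))}"

definition cells ::
  "(nat \<Rightarrow> nat) \<Rightarrow> nat \<Rightarrow> nat \<Rightarrow> (nat \<times> nat \<Rightarrow> nat) \<Rightarrow> (nat \<times> nat) list" where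
  "cells lam i j F = filter (\<lambda>u. F u = j + 1) (map (\<lambda>c. (i, c)) [1..<lam i + 1])"

definition psi_quinv ::
  "nat \<Rightarrow> (nat \<Rightarrow> nat) \<Rightarrow> (nat \<times> nat \<Rightarrow> nat)
       \<Rightarrow> (nat \<times> nat \<Rightarrow> int) \<times> (nat \<times> nat \<Rightarrow> nat list)" where
  "psi_quinv n lam F = (pattern_of n lam (rsort lam F),
     \<lambda>(i, j)\<in>{(i, j). 1 \<le> i \<and> i \<le> j \<and> j < n}.
       map (\<lambda>u. zcount lam u F) (rev (cells lam i j F)))"

definition psi_inv ::
  "nat \<Rightarrow> (nat \<Rightarrow> nat) \<Rightarrow> (nat \<times> nat \<Rightarrow> nat)
       \<Rightarrow> (nat \<times> nat \<Rightarrow> int) \<times> (nat \<times> nat \<Rightarrow> nat list)" where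
  "psi_inv n lam F = (pattern_of n lam (rsort lam F),
     \<lambda>(i, j)\<in>{(i, j). 1 \<le> i \<and> i \<le> j \<and> j < n}.
       map (\<lambda>u. zcount_bar lam u F) (cells lam i j F))"

definition Omega :: "nat \<Rightarrow> (nat \<Rightarrow> nat) \<Rightarrow> (nat \<times> nat \<Rightarrow> nat) \<Rightarrow> (nat \<times> nat \<Rightarrow> nat)" where
  "Omega n lam = inv_into (CSF n lam) (psi_inv n lam) \<circ> psi_quinv n lam"

end

theory Submission
  imports Defs "HOL-Library.Multiset"
begin

text \<open>
  For a cell \<open>c\<close> with entry \<open>j + 1\<close> in row \<open>i\<close>, every cell of the row with entry at most \<open>j\<close> either
  has an entry at most \<open>j + 1\<close> below it or is counted in \<open>zcount\<close> or \<open>zcount_bar\<close> of \<open>c\<close>, so these two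
  numbers add up to \<open>SE\<close> and \<open>psi_quinv\<close> is the box complement of \<open>psi_inv\<close>. To invert \<open>psi_inv\<close>,
  fill the rows from the bottom up and each row with decreasing values \<open>k\<close>: among the free
  positions whose lower neighbour exceeds \<open>k\<close>, choose those which receive \<open>k\<close>. The others receive
  smaller values, so they are precisely the positions counted by \<open>zcount_bar\<close>, and the choice is
  encoded by a partition in a box as a lattice path is. Finally, sorting the attacking pairs
  into triples gives \<open>inv = \<Sum> zcount_bar\<close> and \<open>quinv = \<Sum> zcount\<close> on column strict fillings, and
  \<open>Omega\<close> matches these sums.
\<close>

section \<open>Subsets and partitions in a box\<close>

text \<open>Walk through \<open>R\<close> in increasing order, members of \<open>S\<close> being
  vertical and the others horizontal steps of a lattice path; the list gives the row lengths of the
  partition cut out by this path.\<close>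

definition gap_counts :: "nat set \<Rightarrow> nat set \<Rightarrow> nat list" where
  "gap_counts R S = map (\<lambda>c. card {x \<in> R - S. c < x}) (sorted_list_of_set S)"

lemma sorted_list_of_set_insert_least:
  assumes "finite A" "\<forall>a\<in>A. b < (a::nat)"
  shows "sorted_list_of_set (insert b A) = b # sorted_list_of_set A"
proof -
  have "b \<notin> A" using assms by auto
  then show ?thesis
    using assms by (auto intro!: insort_is_Cons simp: less_imp_le)
qed

text \<open>A new least element outside \<open>S\<close> lies above no member of \<open>S\<close>
  and is never counted. In the next lemma it joins \<open>S\<close> and has all gaps above it, so it
  contributes a first part of full width.\<close>

lemma gap_counts_insert_new:
  assumes "finite A" "\<forall>a\<in>A. b < a" "S \<subseteq> A"
  shows "gap_counts (insert b A) S = gap_counts A S"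
proof -
  have "{x \<in> insert b A - S. c < x} = {x \<in> A - S. c < x}" if "c \<in> S" for c
    using assms that by force
  moreover have "finite S" using assms finite_subset by blast
  ultimately show ?thesis by (simp add: gap_counts_def)
qed

lemma gap_counts_insert_both:
  assumes "finite A" "\<forall>a\<in>A. b < a" "S \<subseteq> A"
  shows "gap_counts (insert b A) (insert b S) = card (A - S) # gap_counts A S"
proof -
  have "finite S" using assms finite_subset by blast
  moreover have "\<forall>a\<in>S. b < a" using assms by auto
  moreover have "insert b A - insert b S = A - S" using assms by auto
  moreover have "{x \<in> A - S. b < x} = A - S" using assms by auto
  ultimately show ?thesis
    by (simp add: gap_counts_def sorted_list_of_set_insert_least del: sorted_list_of_set_insert_remove)
qed

lemma gap_counts_in_box:
  assumes "finite R" "S \<subseteq> R"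
  shows "gap_counts R S \<in> box_partitions (card S) (card (R - S))"
proof -
  have "finite S" using assms finite_subset by blast
  have "sorted_wrt (\<lambda>c d. card {x \<in> R - S. d < x} \<le> card {x \<in> R - S. c < x}) (sorted_list_of_set S)"
    by (rule sorted_wrt_mono_rel[OF _ strict_sorted_list_of_set])
       (auto intro!: card_mono simp: assms)
  moreover have "card {x \<in> R - S. c < x} \<le> card (R - S)" for c
    by (rule card_mono) (auto simp: assms)
  ultimately show ?thesis
    by (auto simp: gap_counts_def box_partitions_def sorted_wrt_map)
qed

text \<open>The least element of \<open>R\<close> belongs to \<open>S\<close> exactly when the first part of \<open>p\<close> has the full
  width \<open>l\<close> of the box.\<close>

lemma ex1_gap_counts:
  assumes "finite R" "card R = m + l" "p \<in> box_partitions m l"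
  shows "\<exists>!S. S \<subseteq> R \<and> gap_counts R S = p"
  using assms
proof (induction R arbitrary: m l p rule: finite_linorder_min_induct)
  case empty
  then show ?case by (auto simp: gap_counts_def box_partitions_def)
next
  case (insert b A)
  have nb: "b \<notin> A" using insert.hyps by auto
  have len: "length p = m" using insert.prems by (simp add: box_partitions_def)
  have cardS: "card S = m" if "finite S" "gap_counts R S = p" for R S
    using that len by (auto simp: gap_counts_def)
  show ?case
  proof (cases "\<exists>q. p = l # q")
    case True
    then obtain q where q: "p = l # q" by blast
    then obtain m' where m': "m = Suc m'" using len by auto
    have q_box: "q \<in> box_partitions m' l"
      using insert.prems(2) q m' by (auto simp: box_partitions_def)
    have cA: "card A = m' + l" using insert.prems m' nb insert.hyps by simp
    from insert.IH[OF cA q_box] obtain S where S: "S \<subseteq> A" "gap_counts A S = q"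
      and uniq: "\<And>S'. S' \<subseteq> A \<Longrightarrow> gap_counts A S' = q \<Longrightarrow> S' = S" by auto
    have fS: "finite S" using S insert.hyps finite_subset by blast
    have cS: "card S = m'"
      using S(2) q_box by (auto simp: gap_counts_def box_partitions_def)
    have "card (A - S) = l" using cA cS S fS by (simp add: card_Diff_subset)
    then have ex: "gap_counts (insert b A) (insert b S) = p"
      using gap_counts_insert_both[OF insert.hyps(1,2) S(1)] S(2) q by simp
    show ?thesis
    proof (rule ex1I[of _ "insert b S"])
      show "insert b S \<subseteq> insert b A \<and> gap_counts (insert b A) (insert b S) = p"
        using S ex by auto
    next
      fix U assume U: "U \<subseteq> insert b A \<and> gap_counts (insert b A) U = p"
      have fU: "finite U" using U insert.hyps finite_subset by blast
      \<comment> \<open>Otherwise the parts count gaps in \<open>A - U\<close>, which has too few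
        elements for the first part \<open>l\<close>.\<close>
      have "b \<in> U"
      proof (rule ccontr)
        assume "b \<notin> U"
        then have UA: "U \<subseteq> A" using U by auto
        then have "gap_counts A U = p"
          using U gap_counts_insert_new[OF insert.hyps(1,2)] by simp
        then have "l \<le> card (A - U)"
          using gap_counts_in_box[OF insert.hyps(1) UA] q by (auto simp: box_partitions_def)
        moreover have "card (A - U) = m' + l - m"
          using cA cardS[OF fU, of "insert b A"] U UA fU by (simp add: card_Diff_subset)
        \<comment> \<open>For \<open>l = 0\<close> the truncated difference gives no contradiction,
          but then \<open>m \<le> m'\<close> does.\<close>
        moreover have "card U \<le> card A" using UA insert.hyps(1) by (rule card_mono[rotated])
        ultimately show False using m' cA cardS[OF fU, of "insert b A"] U by simp
      qed
      then obtain V where V: "U = insert b V" "b \<notin> V" by (meson mk_disjoint_insert)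
      then have VA: "V \<subseteq> A" using U by auto
      have "gap_counts A V = q"
        using gap_counts_insert_both[OF insert.hyps(1,2) VA] U V q by simp
      then show "U = insert b S" using uniq VA V by blast
    qed
  next
    case False
    \<comment> \<open>In a box of width \<open>0\<close> every part equals \<open>l\<close>, so
      \<open>p\<close> would be empty and with it \<open>insert b A\<close>.\<close>
    have "l \<noteq> 0"
    proof
      assume "l = 0"
      then have "p = []" using False insert.prems(2) by (cases p) (auto simp: box_partitions_def)
      then show False using insert.prems(1) len \<open>l = 0\<close> nb insert.hyps by auto
    qed
    then obtain l' where l': "l = Suc l'" by (cases l) auto
    \<comment> \<open>The first part, if any, is below \<open>l\<close> and bounds the others, so
      the box can lose a column.\<close>
    have p_box: "p \<in> box_partitions m l'"
      using insert.prems(2) False l' by (cases p) (fastforce simp: box_partitions_def)+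
    have cA: "card A = m + l'" using insert.prems l' nb insert.hyps by simp
    from insert.IH[OF cA p_box] obtain S where S: "S \<subseteq> A" "gap_counts A S = p"
      and uniq: "\<And>S'. S' \<subseteq> A \<Longrightarrow> gap_counts A S' = p \<Longrightarrow> S' = S" by auto
    show ?thesis
    proof (rule ex1I[of _ S])
      show "S \<subseteq> insert b A \<and> gap_counts (insert b A) S = p"
        using S gap_counts_insert_new[OF insert.hyps(1,2) S(1)] by auto
    next
      fix U assume U: "U \<subseteq> insert b A \<and> gap_counts (insert b A) U = p"
      have fU: "finite U" using U insert.hyps finite_subset by blast
      \<comment> \<open>If \<open>b\<close> were chosen, its part would be the number
        \<open>l\<close> of all gaps, which this case excludes.\<close>
      have "b \<notin> U"
      proof
        assume "b \<in> U"
        then obtain V where V: "U = insert b V" "b \<notin> V" by (meson mk_disjoint_insert)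
        then have VA: "V \<subseteq> A" and fV: "finite V" using U fU by auto
        have p: "p = card (A - V) # gap_counts A V"
          using gap_counts_insert_both[OF insert.hyps(1,2) VA] U V by simp
        have "card V = m - 1" "m \<noteq> 0" using cardS[OF fU, of "insert b A"] U V fV by auto
        then have "card (A - V) = l"
          using VA fV cA l' by (simp add: card_Diff_subset)
        then show False using p False by auto
      qed
      then have "U \<subseteq> A" using U by auto
      then show "U = S" using uniq U gap_counts_insert_new[OF insert.hyps(1,2)] by simp
    qed
  qed
qed

section \<open>Filling a single row\<close>

text \<open>\<open>R\<close> holds the columns of a row, \<open>b\<close> the entries below them,
  \<open>t\<close> the cumulative content and \<open>L k\<close> the list for the cells with entry
  \<open>k\<close>. An arbitrary \<open>R\<close> is allowed because the induction on
  \<open>n\<close> deletes the columns that receive the largest value.\<close>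

definition row_spec ::
  "nat \<Rightarrow> nat set \<Rightarrow> (nat \<Rightarrow> nat) \<Rightarrow> (nat \<Rightarrow> nat) \<Rightarrow> (nat \<Rightarrow> nat list) \<Rightarrow> (nat \<Rightarrow> nat) \<Rightarrow> bool" where
  "row_spec n R b t L a \<longleftrightarrow> a \<in> R \<rightarrow>\<^sub>E {1..n} \<and> (\<forall>x\<in>R. a x < b x) \<and>
     (\<forall>k\<in>{1..n}. card {x \<in> R. a x \<le> k} = t k \<and>
        map (\<lambda>c. card {x \<in> R. c < x \<and> a x < k \<and> k < b x}) (sorted_list_of_set {x \<in> R. a x = k})
          = L k)"

text \<open>Among the positions \<open>x\<close> with \<open>Suc n < b x\<close>, those outside \<open>S\<close> are precisely the ones with
  \<open>a x < Suc n < b x\<close>; hence the list for the value \<open>Suc n\<close> is \<open>gap_counts\<close>.\<close>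

lemma row_spec_Suc_iff:
  assumes "finite R" "t (Suc n) = card R"
  shows "row_spec (Suc n) R b t L a \<longleftrightarrow>
     (\<exists>S. S \<subseteq> {x \<in> R. Suc n < b x} \<and> gap_counts {x \<in> R. Suc n < b x} S = L (Suc n) \<and>
        a \<in> extensional R \<and> (\<forall>x\<in>S. a x = Suc n) \<and>
        row_spec n (R - S) b t L (restrict a (R - S)))" (is "?l \<longleftrightarrow> (\<exists>S. ?r S)")
proof
  assume l: ?l
  define S where "S = {x \<in> R. a x = Suc n}"
  have a: "a \<in> R \<rightarrow>\<^sub>E {1..Suc n}" and ab: "\<And>x. x \<in> R \<Longrightarrow> a x < b x"
    and k: "\<And>k. k \<in> {1..Suc n} \<Longrightarrow> card {x \<in> R. a x \<le> k} = t k \<and>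
        map (\<lambda>c. card {x \<in> R. c < x \<and> a x < k \<and> k < b x}) (sorted_list_of_set {x \<in> R. a x = k})
          = L k"
    using l unfolding row_spec_def by auto
  have SR: "S \<subseteq> {x \<in> R. Suc n < b x}" using ab S_def by force
  have an: "a x \<in> {1..n}" if "x \<in> R - S" for x
    using that a S_def by (auto simp: PiE_iff)
  have "{x \<in> {x \<in> R. Suc n < b x} - S. c < x} = {x \<in> R. c < x \<and> a x < Suc n \<and> Suc n < b x}" for c
    using an S_def by force
  then have 1: "gap_counts {x \<in> R. Suc n < b x} S = L (Suc n)"
    using k[of "Suc n"] by (simp add: gap_counts_def S_def)
  have 2: "row_spec n (R - S) b t L (restrict a (R - S))"
    unfolding row_spec_def
  proof (intro conjI ballI)
    show "restrict a (R - S) \<in> R - S \<rightarrow>\<^sub>E {1..n}" using an by auto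
  next
    fix x assume "x \<in> R - S" then show "restrict a (R - S) x < b x" using ab by auto
  next
    fix j assume j: "j \<in> {1..n}"
    have "{x \<in> R - S. restrict a (R - S) x \<le> j} = {x \<in> R. a x \<le> j}"
      using j S_def by auto
    then show "card {x \<in> R - S. restrict a (R - S) x \<le> j} = t j" using k[of j] j by simp
    have "{x \<in> R - S. c < x \<and> restrict a (R - S) x < j \<and> j < b x} = {x \<in> R. c < x \<and> a x < j \<and> j < b x}" for c
      using j S_def by auto
    moreover have "{x \<in> R - S. restrict a (R - S) x = j} = {x \<in> R. a x = j}"
      using j S_def by auto
    ultimately show "map (\<lambda>c. card {x \<in> R - S. c < x \<and> restrict a (R - S) x < j \<and> j < b x})
      (sorted_list_of_set {x \<in> R - S. restrict a (R - S) x = j}) = L j" using k[of j] j by simp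
  qed
  show "\<exists>S. ?r S"
    using SR 1 2 a by (intro exI[of _ S]) (auto simp: S_def PiE_iff)
next
  assume "\<exists>S. ?r S"
  then obtain S where S: "S \<subseteq> {x \<in> R. Suc n < b x}" and g: "gap_counts {x \<in> R. Suc n < b x} S = L (Suc n)"
    and ext: "a \<in> extensional R" and aS: "\<And>x. x \<in> S \<Longrightarrow> a x = Suc n"
    and rs: "row_spec n (R - S) b t L (restrict a (R - S))" by auto
  have an: "a x \<in> {1..n}" "a x < b x" if "x \<in> R - S" for x
    using rs that unfolding row_spec_def by (auto simp: PiE_iff)
  have k: "\<And>k. k \<in> {1..n} \<Longrightarrow> card {x \<in> R - S. restrict a (R - S) x \<le> k} = t k \<and>
        map (\<lambda>c. card {x \<in> R - S. c < x \<and> restrict a (R - S) x < k \<and> k < b x}) (sorted_list_of_set {x \<in> R - S. restrict a (R - S) x = k})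
          = L k"
    using rs unfolding row_spec_def by auto
  have S_eq: "S = {x \<in> R. a x = Suc n}" using S aS an by force
  have aR: "a x \<in> {1..Suc n}" if "x \<in> R" for x using an[of x] aS[of x] that by (cases "x \<in> S") auto
  show ?l unfolding row_spec_def
  proof (intro conjI ballI)
    show "a \<in> R \<rightarrow>\<^sub>E {1..Suc n}" using ext aR by (auto simp: PiE_iff)
  next
    fix x assume "x \<in> R" then show "a x < b x" using an[of x] aS[of x] S by (cases "x \<in> S") auto
  next
    fix j assume j: "j \<in> {1..Suc n}"
    show "card {x \<in> R. a x \<le> j} = t j"
    proof (cases "j = Suc n")
      case True
      then have "{x \<in> R. a x \<le> j} = R" using aR by auto
      then show ?thesis using True assms by simp
    next
      case False
      then have "{x \<in> R - S. restrict a (R - S) x \<le> j} = {x \<in> R. a x \<le> j}" using j S_eq by auto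
      then show ?thesis using k[of j] j False by auto
    qed
    show "map (\<lambda>c. card {x \<in> R. c < x \<and> a x < j \<and> j < b x}) (sorted_list_of_set {x \<in> R. a x = j}) = L j"
    proof (cases "j = Suc n")
      case True
      have "{x \<in> {x \<in> R. Suc n < b x} - S. c < x} = {x \<in> R. c < x \<and> a x < Suc n \<and> Suc n < b x}" for c
        using an S_eq by force
      then show ?thesis using g True by (simp add: gap_counts_def S_eq[symmetric])
    next
      case False
      then have "{x \<in> R - S. c < x \<and> restrict a (R - S) x < j \<and> j < b x} = {x \<in> R. c < x \<and> a x < j \<and> j < b x}" for c
        using j S_eq by auto
      moreover have "{x \<in> R - S. restrict a (R - S) x = j} = {x \<in> R. a x = j}"
        using j S_eq False by auto
      ultimately show ?thesis using k[of j] j False by auto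
    qed
  qed
qed

text \<open>Induction on the largest value. The columns that may receive it number height plus width
  of its box, so \<open>ex1_gap_counts\<close> determines those that do, and the induction
  hypothesis fills the rest. Monotonicity and interlacing of \<open>t\<close> keep the subtractions
  from truncating.\<close>

lemma ex1_row_spec:
  assumes "finite R" "t 0 = 0" "t n = card R"
    and "\<And>k. k < n \<Longrightarrow> t k \<le> t (Suc k)"
    and "\<And>k. k < n \<Longrightarrow> card {x \<in> R. b x \<le> Suc k} \<le> t k"
    and "\<And>k. k < n \<Longrightarrow>
      L (Suc k) \<in> box_partitions (t (Suc k) - t k) (t k - card {x \<in> R. b x \<le> Suc k})"
  shows "\<exists>!a. row_spec n R b t L a"
  using assms
proof (induction n arbitrary: R)
  case 0
  then have "R = {}" by simp
  then show ?case by (auto simp: row_spec_def)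
next
  case (Suc n)
  define R' where "R' = {x \<in> R. Suc n < b x}"
  have finR': "finite R'" using Suc.prems R'_def by simp
  have "card R = card R' + card {x \<in> R. b x \<le> Suc n}"
    unfolding R'_def using Suc.prems(1)
    by (subst card_Un_disjoint[symmetric]) (auto intro!: arg_cong[where f=card])
  then have cR': "card R' = (t (Suc n) - t n) + (t n - card {x \<in> R. b x \<le> Suc n})"
    using Suc.prems(3) Suc.prems(4)[of n] Suc.prems(5)[of n] by simp
  from ex1_gap_counts[OF finR' cR' Suc.prems(6)] obtain S where
    S: "S \<subseteq> R'" "gap_counts R' S = L (Suc n)"
    and uS: "\<And>U. U \<subseteq> R' \<Longrightarrow> gap_counts R' U = L (Suc n) \<Longrightarrow> U = S" by auto
  have SR: "S \<subseteq> R" using S R'_def by auto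
  have finS: "finite S" using S finR' finite_subset by blast
  have "length (gap_counts R' S) = t (Suc n) - t n"
    using S(2) Suc.prems(6)[of n] by (simp add: box_partitions_def)
  then have cS: "card S = t (Suc n) - t n" by (simp add: gap_counts_def)
  have le: "{x \<in> R - S. b x \<le> Suc k} = {x \<in> R. b x \<le> Suc k}" if "k < n" for k
    using S(1) that R'_def by auto
  have "\<exists>!a. row_spec n (R - S) b t L a"
  proof (rule Suc.IH)
    show "t n = card (R - S)"
      using cS SR finS Suc.prems(3) Suc.prems(4)[of n] by (simp add: card_Diff_subset)
  qed (use Suc.prems le in auto)
  then obtain a where a: "row_spec n (R - S) b t L a"
    and ua: "\<And>a'. row_spec n (R - S) b t L a' \<Longrightarrow> a' = a" by auto
  define f where "f = (\<lambda>x\<in>R. if x \<in> S then Suc n else a x)"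
  have "a \<in> extensional (R - S)" using a by (auto simp: row_spec_def PiE_iff)
  then have fa: "restrict f (R - S) = a" unfolding f_def
    by (auto simp: fun_eq_iff restrict_def extensional_def)
  note iff = row_spec_Suc_iff[where b=b and t=t and n=n, OF Suc.prems(1,3), folded R'_def]
  show ?case
  proof (rule ex1I[of _ f])
    show "row_spec (Suc n) R b t L f"
      unfolding iff using S SR fa a by (intro exI[of _ S]) (auto simp: f_def)
  next
    fix g assume "row_spec (Suc n) R b t L g"
    then obtain U where U: "U \<subseteq> R'" "gap_counts R' U = L (Suc n)" "g \<in> extensional R"
      "\<forall>x\<in>U. g x = Suc n" "row_spec n (R - U) b t L (restrict g (R - U))" unfolding iff by auto
    have "U = S" using uS U by blast
    then have "restrict g (R - S) = a" using ua U by blast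
    then have "g x = a x" if "x \<in> R - S" for x using that by (metis restrict_apply')
    then show "g = f" using U \<open>U = S\<close> by (auto simp: f_def fun_eq_iff extensional_def)
  qed
qed

section \<open>Row contents and patterns\<close>

lemma sorted_list_of_set_interval_filter:
  "sorted_list_of_set {c \<in> {1..N}. P c} = filter P [1..<N + 1]"
proof -
  have "sorted_list_of_set (set (filter P [1..<N + 1])) = filter P [1..<N + 1]"
    by (rule sorted_list_of_set.idem_if_sorted_distinct) (auto intro: sorted_wrt_filter simp del: upt_Suc)
  moreover have "set (filter P [1..<N + 1]) = {c \<in> {1..N}. P c}" by auto
  ultimately show ?thesis by simp
qed

lemma length_filter_shift:
  "length (filter P xs) = card {c \<in> {1..length xs}. P (xs ! (c - 1))}"
proof -
  have "{c \<in> {1..length xs}. P (xs ! (c - 1))} = Suc ` {i. i < length xs \<and> P (xs ! i)}"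
    by (force simp: image_iff gr0_conv_Suc Suc_le_eq)
  then show ?thesis by (simp add: length_filter_conv_card card_image)
qed

lemma card_cells_in_row:
  assumes "\<And>r c. (r, c) \<in> A \<longleftrightarrow> r = i \<and> c \<in> C"
  shows "card A = card C"
proof -
  have "A = Pair i ` C" using assms by auto
  then show ?thesis by (simp add: card_image inj_on_def)
qed

text \<open>For \<open>i \<le> k \<le> n\<close> this is the entry \<open>T (i, k)\<close> of the
  pattern of \<open>rsort lam F\<close>, read off the unsorted row; it also makes sense outside the
  triangle of indices.\<close>

definition row_count :: "(nat \<Rightarrow> nat) \<Rightarrow> (nat \<times> nat \<Rightarrow> nat) \<Rightarrow> nat \<Rightarrow> nat \<Rightarrow> nat" where
  "row_count lam F i k = card {c \<in> {1..lam i}. F (i, c) \<le> k}"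

lemma row_count_filter: "row_count lam F i k = length (filter (\<lambda>x. x \<le> k) (row_entries lam F i))"
proof -
  have "{c \<in> {1..lam i}. row_entries lam F i ! (c - 1) \<le> k} = {c \<in> {1..lam i}. F (i, c) \<le> k}"
    by (auto simp: row_entries_def simp del: upt_Suc)
  then show ?thesis unfolding length_filter_shift by (simp add: row_count_def row_entries_def del: upt_Suc)
qed

lemma pattern_of_rsort:
  assumes "1 \<le> i" "i \<le> j" "j \<le> n"
  shows "pattern_of n lam (rsort lam F) (i, j) = int (row_count lam F i j)"
proof -
  have len: "length (row_entries lam F i) = lam i" by (simp add: row_entries_def)
  have "card {u \<in> dg lam. fst u = i \<and> rsort lam F u \<le> j}
    = card {c \<in> {1..lam i}. sort (row_entries lam F i) ! (c - 1) \<le> j}"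
    using assms by (intro card_cells_in_row[of _ i]) (auto simp: rsort_def dg_def)
  also have "\<dots> = length (filter (\<lambda>x. x \<le> j) (sort (row_entries lam F i)))"
    unfolding length_filter_shift by (simp only: len length_sort)
  also have "\<dots> = row_count lam F i j" unfolding row_count_filter
    by (metis filter_sort length_sort)
  finally show ?thesis using assms by (simp add: pattern_of_def)
qed

text \<open>Consecutive cumulative counts differ by the multiplicity of one value, so they determine
  the multiset.\<close>

lemma sort_eq_if_counts_le_eq:
  assumes "\<And>k. length (filter (\<lambda>x. x \<le> k) xs) = length (filter (\<lambda>x. x \<le> k) ys)"
  shows "sort xs = sort (ys :: nat list)"
proof -
  have split: "length (filter (\<lambda>x. x \<le> Suc k) zs) = length (filter (\<lambda>x. x \<le> k) zs) + count (mset zs) (Suc k)"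
    for k and zs :: "nat list" by (induction zs) auto
  have zero: "length (filter (\<lambda>x. x \<le> 0) zs) = count (mset zs) 0" for zs :: "nat list"
    by (induction zs) auto
  have "count (mset xs) k = count (mset ys) k" for k
    using assms[of k] assms[of "k - 1"] split zero by (cases k) (auto simp del: le_zero_eq)
  then have "mset xs = mset ys" by (rule multiset_eqI)
  then show ?thesis by (metis properties_for_sort sorted_sort mset_sort)
qed

lemma psi_apply:
  assumes "1 \<le> i" "i \<le> j" "j < n"
  shows "snd (psi_inv n lam F) (i, j) = map (\<lambda>u. zcount_bar lam u F) (cells lam i j F)"
    "snd (psi_quinv n lam F) (i, j) = map (\<lambda>u. zcount lam u F) (rev (cells lam i j F))"
  using assms by (simp_all add: psi_inv_def psi_quinv_def)

lemma cells_eq: "cells lam i j F = map (Pair i) (sorted_list_of_set {c \<in> {1..lam i}. F (i, c) = Suc j})"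
  unfolding sorted_list_of_set_interval_filter cells_def by (simp add: filter_map comp_def)

lemma replicate_zero_in_box: "replicate m 0 \<in> box_partitions m l"
proof -
  have "sorted_wrt (\<ge>) (replicate m (0::nat))" by (induction m) auto
  then show ?thesis by (auto simp: box_partitions_def)
qed

section \<open>Complementation in a box\<close>

lemma box_complement_in_box:
  assumes "p \<in> box_partitions m l"
  shows "box_complement l p \<in> box_partitions m l" "box_complement l (box_complement l p) = p"
proof -
  have p: "length p = m" "sorted_wrt (\<ge>) p" "\<And>x. x \<in> set p \<Longrightarrow> x \<le> l"
    using assms by (auto simp: box_partitions_def)
  have "sorted_wrt (\<lambda>x y. x \<le> y) (rev p)" using p(2) by (simp add: sorted_wrt_rev)
  then have "sorted_wrt (\<lambda>x y. l - x \<ge> l - y) (rev p)"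
    by (rule sorted_wrt_mono_rel[rotated]) auto
  then show "box_complement l p \<in> box_partitions m l"
    using p by (auto simp: box_complement_def box_partitions_def sorted_wrt_map)
  have "map (\<lambda>x. l - (l - x)) p = p" using p(3) by (intro map_idI) auto
  then show "box_complement l (box_complement l p) = p"
    by (simp add: box_complement_def rev_map comp_def)
qed

lemma boxcomp_in_POP:
  assumes "P \<in> POP n lam"
  shows "boxcomp n P \<in> POP n lam" "boxcomp n (boxcomp n P) = P"
proof -
  obtain T L where P: "P = (T, L)" "T \<in> GT n lam" "L \<in> extensional {(i, j). 1 \<le> i \<and> i \<le> j \<and> j < n}"
    and L: "\<And>i j. 1 \<le> i \<Longrightarrow> i \<le> j \<Longrightarrow> j < n \<Longrightarrow> L (i, j) \<in> box_partitions (nat (NE T i j)) (nat (SE T i j))"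
    using assms by (auto simp: POP_def PiE_iff)
  show "boxcomp n P \<in> POP n lam"
    using P box_complement_in_box(1)[OF L] by (auto simp: POP_def boxcomp_def)
  show "boxcomp n (boxcomp n P) = P"
    using P box_complement_in_box(2)[OF L] by (auto simp: boxcomp_def fun_eq_iff restrict_def extensional_def)
qed

section \<open>The bijections\<close>

locale partition_at_most =
  fixes n :: nat and lam :: "nat \<Rightarrow> nat"
  assumes lam_decr: "\<And>r. r \<ge> 1 \<Longrightarrow> lam (Suc r) \<le> lam r"
    and lam_zero: "\<And>r. r > n \<Longrightarrow> lam r = 0"
begin

lemma lam_Suc_le: "1 \<le> r \<Longrightarrow> c \<le> lam (Suc r) \<Longrightarrow> c \<le> lam r"
  using lam_decr[of r] by simp

lemma finite_dg: "finite (dg lam)"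
proof -
  have "dg lam \<subseteq> Sigma {1..n} (\<lambda>r. {1..lam r})"
  proof
    fix u assume "u \<in> dg lam"
    then obtain r c where "u = (r, c)" "1 \<le> r" "1 \<le> c" "c \<le> lam r" by (auto simp: dg_def)
    then show "u \<in> Sigma {1..n} (\<lambda>r. {1..lam r})" using lam_zero[of r] by (cases "n < r") auto
  qed
  then show ?thesis by (rule finite_subset) auto
qed

lemma CSF_range: "F \<in> CSF n lam \<Longrightarrow> 1 \<le> i \<Longrightarrow> 1 \<le> c \<Longrightarrow> c \<le> lam i \<Longrightarrow> F (i, c) \<in> {1..n}"
  unfolding CSF_def by (auto simp: PiE_iff dg_def)

lemma CSF_column:
  "F \<in> CSF n lam \<Longrightarrow> 1 \<le> i \<Longrightarrow> 1 \<le> c \<Longrightarrow> c \<le> lam (Suc i) \<Longrightarrow> F (i, c) < F (Suc i, c)"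
  using lam_Suc_le[of i c] unfolding CSF_def by (auto simp: dg_def)

text \<open>The \<open>i - 1\<close> entries above the cell are positive and strictly increasing.
  Hence triangular patterns lose no information.\<close>

lemma CSF_ge_row:
  assumes "F \<in> CSF n lam" "1 \<le> i" "1 \<le> c" "c \<le> lam i"
  shows "i \<le> F (i, c)"
  using assms(2,4)
proof (induction i rule: nat_induct_at_least)
  case base
  then show ?case using CSF_range[OF assms(1) _ assms(3)] by fastforce
next
  case (Suc i)
  then show ?case using CSF_column[OF assms(1) _ assms(3)] lam_Suc_le[of i c] by fastforce
qed

text \<open>\<open>Suc n\<close> plays the role of infinity.\<close>

definition below :: "(nat \<times> nat \<Rightarrow> nat) \<Rightarrow> nat \<Rightarrow> nat \<Rightarrow> nat" where
  "below F i c = (if c \<le> lam (Suc i) then F (Suc i, c) else Suc n)"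

text \<open>The bound \<open>k \<le> n\<close> keeps the infinite entry \<open>Suc n\<close> from
  being counted.\<close>

lemma card_below_le:
  assumes "1 \<le> i" "k \<le> n"
  shows "card {c \<in> {1..lam i}. below F i c \<le> k} = row_count lam F (Suc i) k"
proof -
  have "{c \<in> {1..lam i}. below F i c \<le> k} = {c \<in> {1..lam (Suc i)}. F (Suc i, c) \<le> k}"
    using assms lam_Suc_le by (auto simp: below_def)
  then show ?thesis by (simp add: row_count_def)
qed

lemma zcount_row:
  assumes F: "F \<in> CSF n lam" and i: "1 \<le> i" and c: "c \<in> {1..lam i}"
  shows "zcount_bar lam (i, c) F =
      card {x \<in> {1..lam i}. c < x \<and> F (i, x) < F (i, c) \<and> F (i, c) < below F i x}" (is "?a = ?A")
    "zcount lam (i, c) F =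
      card {x \<in> {1..lam i}. x < c \<and> F (i, x) < F (i, c) \<and> F (i, c) < below F i x}" (is "?b = ?B")
proof -
  \<comment> \<open>An entry at most \<open>n\<close> is smaller than \<open>Suc n\<close>, so the
    two alternatives in \<open>zcount\<close> merge into one comparison with
    \<open>below\<close>.\<close>
  have Fc: "F (i, c) \<le> n" using CSF_range[OF F i] c by auto
  show "?a = ?A" "?b = ?B" unfolding zcount_bar_def zcount_def
    by (intro card_cells_in_row[of _ i]; use i Fc in \<open>auto simp: dg_def down_def below_def\<close>)+
qed

lemma CSF_lt_below: "F \<in> CSF n lam \<Longrightarrow> 1 \<le> i \<Longrightarrow> c \<in> {1..lam i} \<Longrightarrow> F (i, c) < below F i c"
  using CSF_column[of F i c] CSF_range[of F i c] by (auto simp: below_def)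

text \<open>Cells with entry at most \<open>j\<close> are split by the entry below them. If it
  exceeds \<open>Suc j\<close>, they are counted left or right of \<open>c\<close>; if not, column
  strictness makes the bound \<open>j\<close> automatic. The additive form avoids subtraction of
  naturals.\<close>

lemma zcount_add:
  assumes F: "F \<in> CSF n lam" and i: "1 \<le> i" and c: "c \<in> {1..lam i}" and Fc: "F (i, c) = Suc j"
  shows "zcount lam (i, c) F + zcount_bar lam (i, c) F + row_count lam F (Suc i) (Suc j) = row_count lam F i j"
proof -
  let ?P = "\<lambda>x. F (i, x) < F (i, c) \<and> F (i, c) < below F i x"
  have j: "Suc j \<le> n" using CSF_range[OF F i, of c] c Fc by auto
  have "row_count lam F i j = card ({x \<in> {1..lam i}. x < c \<and> ?P x} \<union> {x \<in> {1..lam i}. c < x \<and> ?P x} \<union>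
     {x \<in> {1..lam i}. below F i x \<le> Suc j})"
    unfolding row_count_def
  proof (intro arg_cong[where f = card] set_eqI)
    fix x
    show "x \<in> {c \<in> {1..lam i}. F (i, c) \<le> j} \<longleftrightarrow> x \<in> {x \<in> {1..lam i}. x < c \<and> ?P x} \<union>
      {x \<in> {1..lam i}. c < x \<and> ?P x} \<union> {x \<in> {1..lam i}. below F i x \<le> Suc j}"
      using Fc c CSF_lt_below[OF F i, of x] CSF_lt_below[OF F i, of c]
      by (cases x c rule: linorder_cases) auto
  qed
  also have "\<dots> = card {x \<in> {1..lam i}. x < c \<and> ?P x} + card {x \<in> {1..lam i}. c < x \<and> ?P x} +
     card {x \<in> {1..lam i}. below F i x \<le> Suc j}"
    by (subst card_Un_disjoint card_Un_disjoint; (auto simp: Fc)[1])+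
  finally show ?thesis using zcount_row[OF F i c] card_below_le[OF i j] by simp
qed

lemma row_count_mono: "j \<le> k \<Longrightarrow> row_count lam F i j \<le> row_count lam F i k"
  unfolding row_count_def by (rule card_mono) auto

text \<open>By column strictness, an entry at most \<open>Suc j\<close> has an entry at most
  \<open>j\<close> above it.\<close>

lemma row_count_interlace:
  assumes F: "F \<in> CSF n lam" and i: "1 \<le> i" and j: "j < n"
  shows "row_count lam F (Suc i) (Suc j) \<le> row_count lam F i j"
proof -
  have "{c \<in> {1..lam i}. below F i c \<le> Suc j} \<subseteq> {c \<in> {1..lam i}. F (i, c) \<le> j}"
    using CSF_lt_below[OF F i] by fastforce
  then have "card {c \<in> {1..lam i}. below F i c \<le> Suc j} \<le> row_count lam F i j"
    unfolding row_count_def by (intro card_mono) auto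
  then show ?thesis using card_below_le[OF i, of "Suc j"] j by simp
qed

lemma row_count_full: "F \<in> CSF n lam \<Longrightarrow> 1 \<le> i \<Longrightarrow> row_count lam F i n = lam i"
proof -
  assume "F \<in> CSF n lam" "1 \<le> i"
  then have "{c \<in> {1..lam i}. F (i, c) \<le> n} = {1..lam i}" using CSF_range[of F i] by fastforce
  then show ?thesis by (simp add: row_count_def)
qed

lemma row_count_zero:
  "F \<in> CSF n lam \<Longrightarrow> 1 \<le> i \<Longrightarrow> k < i \<Longrightarrow> row_count lam F i k = 0"
  using CSF_ge_row[of F i] by (fastforce simp: row_count_def)

section \<open>From fillings to patterns with boxed partitions\<close>

lemma pattern_in_GT:
  assumes F: "F \<in> CSF n lam"
  shows "pattern_of n lam (rsort lam F) \<in> GT n lam"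
proof -
  have "pattern_of n lam (rsort lam F) \<in> extensional {(i, j). 1 \<le> i \<and> i \<le> j \<and> j \<le> n}"
    by (simp add: pattern_of_def)
  then show ?thesis
    using row_count_full[OF F] row_count_mono[of _ _ F] row_count_interlace[OF F]
    by (auto simp: GT_def NE_def SE_def PiE_iff pattern_of_rsort)
qed

lemma SE_NE_pattern:
  assumes "1 \<le> i" "i \<le> j" "j < n"
  shows "SE (pattern_of n lam (rsort lam F)) i j = int (row_count lam F i j) - int (row_count lam F (Suc i) (Suc j))"
    "NE (pattern_of n lam (rsort lam F)) i j = int (row_count lam F i (Suc j)) - int (row_count lam F i j)"
  using assms by (simp_all add: SE_def NE_def pattern_of_rsort)

lemma card_row_value:
  "card {c \<in> {1..lam i}. F (i, c) = Suc j} = row_count lam F i (Suc j) - row_count lam F i j"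
proof -
  have "{c \<in> {1..lam i}. F (i, c) = Suc j} =
    {c \<in> {1..lam i}. F (i, c) \<le> Suc j} - {c \<in> {1..lam i}. F (i, c) \<le> j}" by auto
  then show ?thesis unfolding row_count_def by (simp add: card_Diff_subset subset_iff)
qed

lemma psi_inv_in_POP:
  assumes F: "F \<in> CSF n lam"
  shows "psi_inv n lam F \<in> POP n lam"
proof -
  let ?T = "pattern_of n lam (rsort lam F)"
  have "map (\<lambda>u. zcount_bar lam u F) (cells lam i j F) \<in> box_partitions (nat (NE ?T i j)) (nat (SE ?T i j))"
    if ij: "1 \<le> i" "i \<le> j" "j < n" for i j
  proof -
    let ?C = "{c \<in> {1..lam i}. F (i, c) = Suc j}"
    have "sorted_wrt (\<lambda>c d. zcount_bar lam (i, d) F \<le> zcount_bar lam (i, c) F) (sorted_list_of_set ?C)"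
    proof (rule sorted_wrt_mono_rel[OF _ strict_sorted_list_of_set])
      fix c d assume "c \<in> set (sorted_list_of_set ?C)" "d \<in> set (sorted_list_of_set ?C)" "c < d"
      then show "zcount_bar lam (i, d) F \<le> zcount_bar lam (i, c) F"
        using zcount_row(1)[OF F ij(1)] by (auto intro!: card_mono)
    qed
    moreover have "zcount_bar lam (i, c) F \<le> nat (SE ?T i j)" if "c \<in> ?C" for c
      using zcount_add[OF F ij(1), of c j] that SE_NE_pattern[OF ij, of F] by auto
    moreover have "card ?C = nat (NE ?T i j)"
      using card_row_value SE_NE_pattern(2)[OF ij, of F] row_count_mono[of j "Suc j" F i] by simp
    ultimately show ?thesis
      by (auto simp: cells_eq box_partitions_def sorted_wrt_map)
  qed
  then show ?thesis using pattern_in_GT[OF F]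
    by (auto simp: POP_def psi_inv_def)
qed

text \<open>\<open>zcount_add\<close> complements each part in \<open>SE\<close>, and the opposite
  reading directions of the two maps account for the reversal in
  \<open>box_complement\<close>.\<close>

lemma psi_quinv_eq_boxcomp:
  assumes F: "F \<in> CSF n lam"
  shows "psi_quinv n lam F = boxcomp n (psi_inv n lam F)"
proof -
  let ?T = "pattern_of n lam (rsort lam F)"
  have "map (\<lambda>u. zcount lam u F) (rev (cells lam i j F)) =
    box_complement (nat (SE ?T i j)) (map (\<lambda>u. zcount_bar lam u F) (cells lam i j F))"
    if ij: "1 \<le> i" "i \<le> j" "j < n" for i j
  proof -
    have "zcount lam u F = nat (SE ?T i j) - zcount_bar lam u F" if "u \<in> set (cells lam i j F)" for u
      using zcount_add[OF F ij(1)] that SE_NE_pattern(1)[OF ij, of F] by (fastforce simp: cells_eq)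
    then show ?thesis by (simp add: box_complement_def rev_map)
  qed
  then show ?thesis by (auto simp: psi_quinv_def psi_inv_def boxcomp_def fun_eq_iff restrict_def)
qed

text \<open>The boxes for entries at most the row index are not part of the data of a pattern; they have
  width or height \<open>0\<close>.\<close>

definition spec_count :: "(nat \<times> nat \<Rightarrow> int) \<Rightarrow> nat \<Rightarrow> nat \<Rightarrow> nat" where
  "spec_count T i k = (if i \<le> k then nat (T (i, k)) else 0)"

text \<open>The shift \<open>k - 1\<close> is there because \<open>L (i, j)\<close> describes the
  entries \<open>j + 1\<close>. For \<open>k = i\<close> the list has one zero per entry
  \<open>i\<close>; for \<open>k < i\<close> it is empty.\<close>

definition spec_list ::
  "(nat \<times> nat \<Rightarrow> int) \<Rightarrow> (nat \<times> nat \<Rightarrow> nat list) \<Rightarrow> nat \<Rightarrow> nat \<Rightarrow> nat list" where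
  "spec_list T L i k = (if i < k then L (i, k - 1) else replicate (spec_count T i k) 0)"

text \<open>Only rows \<open>i\<close> and \<open>Suc i\<close> of \<open>F\<close> enter, which
  permits a construction from the bottom up.\<close>

definition row_ok ::
  "(nat \<times> nat \<Rightarrow> int) \<Rightarrow> (nat \<times> nat \<Rightarrow> nat list) \<Rightarrow> (nat \<times> nat \<Rightarrow> nat) \<Rightarrow> nat \<Rightarrow> bool" where
  "row_ok T L F i \<longleftrightarrow> row_spec n {1..lam i} (below F i) (spec_count T i) (spec_list T L i)
     (\<lambda>c\<in>{1..lam i}. F (i, c))"

lemma row_ok_iff:
  "row_ok T L F i \<longleftrightarrow> (\<forall>c\<in>{1..lam i}. F (i, c) \<in> {1..n} \<and> F (i, c) < below F i c) \<and>
     (\<forall>k\<in>{1..n}. row_count lam F i k = spec_count T i k \<and>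
        map (\<lambda>c. card {x \<in> {1..lam i}. c < x \<and> F (i, x) < k \<and> k < below F i x})
          (sorted_list_of_set {c \<in> {1..lam i}. F (i, c) = k}) = spec_list T L i k)"
proof -
  let ?f = "\<lambda>c\<in>{1..lam i}. F (i, c)"
  have "{x \<in> {1..lam i}. ?f x \<le> k} = {x \<in> {1..lam i}. F (i, x) \<le> k}"
    "{x \<in> {1..lam i}. ?f x = k} = {x \<in> {1..lam i}. F (i, x) = k}"
    "{x \<in> {1..lam i}. c < x \<and> ?f x < k \<and> k < below F i x} =
       {x \<in> {1..lam i}. c < x \<and> F (i, x) < k \<and> k < below F i x}" for c k
    by auto
  then show ?thesis unfolding row_ok_def row_spec_def row_count_def
    by (auto simp: PiE_iff)
qed

lemma CSF_row_ok:
  assumes F: "F \<in> CSF n lam" and psi: "psi_inv n lam F = (T, L)" and i: "1 \<le> i"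
  shows "row_ok T L F i"
  unfolding row_ok_iff
proof (intro conjI ballI)
  fix c assume "c \<in> {1..lam i}"
  then show "F (i, c) \<in> {1..n}" "F (i, c) < below F i c"
    using CSF_range[OF F i] CSF_lt_below[OF F i] by auto
next
  fix k assume k: "k \<in> {1..n}"
  show count: "row_count lam F i k = spec_count T i k"
    using psi pattern_of_rsort[OF i, of k n lam F] row_count_zero[OF F i, of k] k
    by (auto simp: psi_inv_def spec_count_def)
  let ?C = "{c \<in> {1..lam i}. F (i, c) = k}"
  let ?Z = "\<lambda>c. card {x \<in> {1..lam i}. c < x \<and> F (i, x) < k \<and> k < below F i x}"
  have Z: "zcount_bar lam (i, c) F = ?Z c" if "c \<in> ?C" for c
    using zcount_row(1)[OF F i, of c] that by simp
  show "map ?Z (sorted_list_of_set ?C) = spec_list T L i k"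
  proof (cases "i < k")
    case True
    then obtain j where j: "k = Suc j" by (cases k) auto
    have "L (i, j) = map (\<lambda>u. zcount_bar lam u F) (cells lam i j F)"
      using psi_apply(1)[of i j n lam F] True j k i psi by auto
    also have "\<dots> = map ?Z (sorted_list_of_set ?C)"
      using Z by (simp add: cells_eq j)
    finally show ?thesis using True j by (simp add: spec_list_def)
  next
    case False
    \<comment> \<open>For \<open>k \<le> i\<close> no entry of row \<open>i\<close> is smaller than
      \<open>k\<close>, so every count in the list is \<open>0\<close> and the cells with entry
      \<open>k\<close> are all those with entry at most \<open>k\<close>.\<close>
    have ge: "k \<le> F (i, x)" if "x \<in> {1..lam i}" for x
      using CSF_ge_row[OF F i, of x] False that by auto
    then have "?Z c = 0" for c by (auto simp: leD)
    moreover have "card ?C = spec_count T i k"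
    proof -
      have "{c \<in> {1..lam i}. F (i, c) \<le> k} = ?C" using ge by (auto intro: le_antisym)
      then show ?thesis using count by (simp add: row_count_def)
    qed
    ultimately show ?thesis using False
      by (simp only: spec_list_def map_replicate_const sorted_list_of_set.length_sorted_key_list_of_set) simp
  qed
qed

section \<open>Reconstruction of a filling, row by row\<close>

lemma GT_nonneg:
  assumes "T \<in> GT n lam" "1 \<le> i" "i \<le> j" "j \<le> n"
  shows "0 \<le> T (i, j)"
  using assms(4,2,3)
proof (induction j arbitrary: i rule: inc_induct)
  case base
  then show ?case using assms(1) by (simp add: GT_def)
next
  case (step j)
  \<comment> \<open>Along the diagonal the entries decrease weakly to one with second index
    \<open>n\<close>, which is a part of \<open>lam\<close>.\<close>
  have "0 \<le> T (Suc i, Suc j)" using step.IH[of "Suc i"] step.prems by simp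
  also have "\<dots> \<le> T (i, j)" using assms(1) step.prems step.hyps by (simp add: GT_def SE_def)
  finally show ?case .
qed

text \<open>Nonnegativity of \<open>NE\<close> and \<open>SE\<close> supplies the monotonicity and
  interlacing assumed in \<open>ex1_row_spec\<close>. Of the rows already filled, only the content
  of row \<open>Suc i\<close> has to be right.\<close>

lemma ex1_row_ok:
  assumes P: "(T, L) \<in> POP n lam" and i: "1 \<le> i" "i \<le> n"
    and row: "\<And>k. k \<in> {1..n} \<Longrightarrow> row_count lam F (Suc i) k = spec_count T (Suc i) k"
  shows "\<exists>!a. row_spec n {1..lam i} (below F i) (spec_count T i) (spec_list T L i) a"
proof -
  have GT: "T \<in> GT n lam" using P by (simp add: POP_def)
  then have T: "\<And>i. 1 \<le> i \<Longrightarrow> i \<le> n \<Longrightarrow> T (i, n) = int (lam i)"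
    and NE: "\<And>i j. 1 \<le> i \<Longrightarrow> i \<le> j \<Longrightarrow> j < n \<Longrightarrow> T (i, j) \<le> T (i, Suc j)"
    and SE: "\<And>i j. 1 \<le> i \<Longrightarrow> i \<le> j \<Longrightarrow> j < n \<Longrightarrow> T (Suc i, Suc j) \<le> T (i, j)"
    by (auto simp: GT_def NE_def SE_def)
  have L: "L (i, j) \<in> box_partitions (nat (NE T i j)) (nat (SE T i j))" if "i \<le> j" "j < n" for j
    using P that i by (auto simp: POP_def PiE_iff)
  note pos = GT_nonneg[OF GT]
  have below: "card {c \<in> {1..lam i}. below F i c \<le> Suc k} = spec_count T (Suc i) (Suc k)" if "k < n" for k
    using card_below_le[OF i(1), of "Suc k" F] row[of "Suc k"] that by simp
  show ?thesis
  proof (rule ex1_row_spec)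
    show "spec_count T i 0 = 0" using i by (simp add: spec_count_def)
    show "spec_count T i n = card {1..lam i}" using i T by (simp add: spec_count_def)
  next
    fix k assume k: "k < n"
    show "spec_count T i k \<le> spec_count T i (Suc k)"
      using NE[of i k] i k by (simp add: spec_count_def nat_mono)
    show "card {c \<in> {1..lam i}. below F i c \<le> Suc k} \<le> spec_count T i k"
      unfolding below[OF k] using SE[of i k] i k by (simp add: spec_count_def nat_mono)
    show "spec_list T L i (Suc k) \<in> box_partitions (spec_count T i (Suc k) - spec_count T i k)
        (spec_count T i k - card {c \<in> {1..lam i}. below F i c \<le> Suc k})"
    proof (cases "i \<le> k")
      case True
      have "nat (NE T i k) = spec_count T i (Suc k) - spec_count T i k"
        using True pos[of i k] i k by (simp add: NE_def spec_count_def nat_diff_distrib')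
      moreover have "nat (SE T i k) = spec_count T i k - spec_count T (Suc i) (Suc k)"
        using True pos[of "Suc i" "Suc k"] i k by (simp add: SE_def spec_count_def nat_diff_distrib')
      ultimately show ?thesis using L[OF True k] True below[OF k] by (simp add: spec_list_def)
    next
      case False
      \<comment> \<open>Here \<open>spec_count T i k = 0\<close>, so the box has width
        \<open>0\<close> and admits only a list of zeros.\<close>
      then show ?thesis by (auto simp: spec_list_def spec_count_def replicate_zero_in_box)
    qed
  qed simp
qed

lemma row_ok_bottom:
  assumes "n < i" shows "row_ok T L F i"
  using assms by (auto simp: row_ok_iff lam_zero row_count_def spec_count_def spec_list_def)

text \<open>Induction on the number \<open>m\<close> of rows filled, from row \<open>n\<close>
  upwards; the rows after row \<open>n\<close> are empty.\<close>

lemma ex_rows_ok: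
  assumes P: "(T, L) \<in> POP n lam" and m: "m \<le> n"
  shows "\<exists>F. \<forall>i. n - m < i \<longrightarrow> row_ok T L F i"
  using m
proof (induction m)
  case 0
  then show ?case using row_ok_bottom by auto
next
  case (Suc m)
  then obtain F where F: "\<And>i. n - m < i \<Longrightarrow> row_ok T L F i" by auto
  define i where "i = n - m"
  have i: "1 \<le> i" "i \<le> n" using Suc.prems i_def by auto
  have "row_count lam F (Suc i) k = spec_count T (Suc i) k" if "k \<in> {1..n}" for k
    using F[of "Suc i"] that by (auto simp: row_ok_iff i_def)
  from ex1_row_ok[OF P i this] obtain a where
    a: "row_spec n {1..lam i} (below F i) (spec_count T i) (spec_list T L i) a" by blast
  \<comment> \<open>Replacing row \<open>i\<close> affects neither the rows below it nor the values
    \<open>below F i\<close> from which \<open>a\<close> was obtained.\<close>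
  define G where "G = (\<lambda>(r, c). if r = i then a c else F (r, c))"
  have "row_ok T L G k" if k: "n - Suc m < k" for k
  proof (cases "k = i")
    case True
    have "(\<lambda>c\<in>{1..lam i}. G (i, c)) = a"
      using a by (auto simp: G_def row_spec_def PiE_iff fun_eq_iff extensional_def)
    moreover have "below G i = below F i" by (auto simp: below_def G_def fun_eq_iff)
    ultimately show ?thesis using a True by (simp add: row_ok_def)
  next
    case False
    then have "i < k" using k Suc.prems by (simp add: i_def)
    then have "\<And>c. G (k, c) = F (k, c)" "below G k = below F k"
      by (auto simp: below_def G_def fun_eq_iff)
    then show ?thesis using F[of k] \<open>i < k\<close> by (simp add: row_ok_def i_def)
  qed
  then show ?case by blast
qed

text \<open>The filling built from the bottom satisfies \<open>row_ok\<close> for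
  \<open>(T, L)\<close> and, by \<open>CSF_row_ok\<close>, also for its own image. Since
  \<open>row_ok\<close> fixes counts and lists, the two pairs coincide.\<close>

lemma psi_inv_surj:
  assumes P: "(T, L) \<in> POP n lam"
  shows "(T, L) \<in> psi_inv n lam ` CSF n lam"
proof -
  obtain F where "\<forall>i. n - n < i \<longrightarrow> row_ok T L F i" using ex_rows_ok[OF P le_refl] by blast
  then have F: "\<And>i. 1 \<le> i \<Longrightarrow> row_ok T L F i" by simp
  define G where "G = restrict F (dg lam)"
  have GF: "G (i, c) = F (i, c)" if "1 \<le> i" "c \<in> {1..lam i}" for i c
    using that by (simp add: G_def dg_def)
  have GF': "below G i c = below F i c" if "1 \<le> i" "c \<in> {1..lam i}" for i c
    using that GF[of "Suc i" c] by (auto simp: below_def)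
  have Gok: "row_ok T L G i" if i: "1 \<le> i" for i
  proof -
    have "{x \<in> {1..lam i}. c < x \<and> G (i, x) < k \<and> k < below G i x} =
      {x \<in> {1..lam i}. c < x \<and> F (i, x) < k \<and> k < below F i x}"
      "{c \<in> {1..lam i}. G (i, c) = k} = {c \<in> {1..lam i}. F (i, c) = k}"
      "{c \<in> {1..lam i}. G (i, c) \<le> k} = {c \<in> {1..lam i}. F (i, c) \<le> k}" for c k
      using GF[OF i] GF'[OF i] by auto
    then show ?thesis using F[OF i] GF[OF i] GF'[OF i] by (simp add: row_ok_iff row_count_def)
  qed
  have G: "G \<in> CSF n lam"
    unfolding CSF_def
  proof (intro CollectI conjI allI impI)
    show "G \<in> dg lam \<rightarrow>\<^sub>E {1..n}"
      using Gok by (fastforce simp: PiE_iff row_ok_iff dg_def G_def)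
  next
    fix r c assume "(r, c) \<in> dg lam" "(Suc r, c) \<in> dg lam"
    then have "1 \<le> r" "c \<in> {1..lam r}" "c \<le> lam (Suc r)" by (auto simp: dg_def)
    moreover then have "G (r, c) < below G r c" using Gok[of r] by (simp add: row_ok_iff)
    ultimately show "G (r, c) < G (Suc r, c)" by (simp add: below_def)
  qed
  obtain T' L' where psi: "psi_inv n lam G = (T', L')" by fastforce
  then have P': "(T', L') \<in> POP n lam" using psi_inv_in_POP[OF G] by simp
  have ok': "row_ok T' L' G i" if "1 \<le> i" for i using CSF_row_ok[OF G psi that] .
  have "T (i, j) = T' (i, j)" if ij: "1 \<le> i" "i \<le> j" "j \<le> n" for i j
  proof -
    have "spec_count T i j = spec_count T' i j"
      using Gok[OF ij(1)] ok'[OF ij(1)] ij by (auto simp: row_ok_iff)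
    moreover have "0 \<le> T (i, j)" "0 \<le> T' (i, j)"
      using GT_nonneg[OF _ ij] P P' by (auto simp: POP_def)
    ultimately show ?thesis using ij by (simp add: spec_count_def)
  qed
  then have "T = T'" using P P' by (auto simp: POP_def GT_def PiE_iff intro!: extensionalityI)
  have "L (i, j) = L' (i, j)" if ij: "1 \<le> i" "i \<le> j" "j < n" for i j
  proof -
    have "spec_list T L i (Suc j) = spec_list T' L' i (Suc j)"
      using Gok[OF ij(1)] ok'[OF ij(1)] ij by (auto simp: row_ok_iff)
    then show ?thesis using ij by (auto simp: spec_list_def)
  qed
  then have "L = L'" using P P' by (auto simp: POP_def PiE_iff intro!: extensionalityI)
  then show ?thesis using psi G \<open>T = T'\<close> by (metis imageI)
qed

text \<open>Induction upwards from the empty row \<open>Suc n\<close>: agreement one row lower gives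
  both fillings the same \<open>below\<close>, and \<open>ex1_row_ok\<close> then forces equal
  rows.\<close>

lemma psi_inv_inj: "inj_on (psi_inv n lam) (CSF n lam)"
proof (rule inj_onI)
  fix F G assume F: "F \<in> CSF n lam" and G: "G \<in> CSF n lam" and eq: "psi_inv n lam F = psi_inv n lam G"
  obtain T L where psi: "psi_inv n lam F = (T, L)" by fastforce
  then have P: "(T, L) \<in> POP n lam" using psi_inv_in_POP[OF F] by simp
  have agree: "\<forall>c\<in>{1..lam i}. F (i, c) = G (i, c)" if i: "1 \<le> i" "i \<le> Suc n" for i
    using i(2,1)
  proof (induction rule: inc_induct)
    case base
    then show ?case using lam_zero by simp
  next
    case (step i)
    let ?a = "\<lambda>c\<in>{1..lam i}. F (i, c)" and ?b = "\<lambda>c\<in>{1..lam i}. G (i, c)"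
    have b: "below F i c = below G i c" if "c \<in> {1..lam i}" for c
      using step that by (auto simp: below_def)
    have ok: "row_ok T L F k" "row_ok T L G k" if "1 \<le> k" for k
      using CSF_row_ok[OF F psi that] CSF_row_ok[OF G _ that] psi eq by auto
    have "row_spec n {1..lam i} (below F i) (spec_count T i) (spec_list T L i) ?b
      = row_spec n {1..lam i} (below G i) (spec_count T i) (spec_list T L i) ?b"
      using b by (simp add: row_spec_def cong: conj_cong)
    then have "row_spec n {1..lam i} (below F i) (spec_count T i) (spec_list T L i) ?a"
      "row_spec n {1..lam i} (below F i) (spec_count T i) (spec_list T L i) ?b"
      using ok[OF step.prems] by (auto simp: row_ok_def)
    moreover have "row_count lam F (Suc i) k = spec_count T (Suc i) k" if "k \<in> {1..n}" for k
      using ok(1)[of "Suc i"] that by (auto simp: row_ok_iff)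
    ultimately have "?a = ?b" using ex1_row_ok[OF P step.prems, of F] step.hyps by auto
    then show ?case by (metis restrict_apply')
  qed
  show "F = G"
  proof (rule extensionalityI[of _ "dg lam"])
    show "F \<in> extensional (dg lam)" "G \<in> extensional (dg lam)"
      using F G by (auto simp: CSF_def PiE_iff)
    fix u assume "u \<in> dg lam"
    then obtain i c where u: "u = (i, c)" "1 \<le> i" "c \<in> {1..lam i}" by (auto simp: dg_def)
    then have "i \<le> n" using lam_zero[of i] by (cases "n < i") auto
    then show "F u = G u" using agree[of i] u by auto
  qed
qed

lemma bij_psi_inv: "bij_betw (psi_inv n lam) (CSF n lam) (POP n lam)"
  unfolding bij_betw_def using psi_inv_inj psi_inv_in_POP psi_inv_surj by auto

lemma bij_psi_quinv: "bij_betw (psi_quinv n lam) (CSF n lam) (POP n lam)"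
proof -
  have "bij_betw (boxcomp n) (POP n lam) (POP n lam)"
    by (rule bij_betw_byWitness[where f' = "boxcomp n"]) (use boxcomp_in_POP in auto)
  from bij_betw_trans[OF bij_psi_inv this]
  show ?thesis by (rule bij_betw_cong[THEN iffD1, rotated]) (simp add: psi_quinv_eq_boxcomp)
qed

section \<open>The statistics\<close>

lemma fst_down [simp]: "fst (down u) = Suc (fst u)" and snd_down [simp]: "snd (down u) = snd u"
  and fst_up [simp]: "fst (up u) = fst u - 1" and snd_up [simp]: "snd (up u) = snd u"
  and up_down [simp]: "up (down u) = u" and down_up [simp]: "0 < fst u \<Longrightarrow> down (up u) = u"
  by (auto simp: down_def up_def prod_eq_iff)

lemma dg_row: "(r, c) \<in> dg lam \<Longrightarrow> 0 < r"
  by (auto simp: dg_def)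

lemma up_in_dg: "u \<in> dg lam \<Longrightarrow> 1 < fst u \<Longrightarrow> up u \<in> dg lam"
  using lam_Suc_le[of "fst u - 1" "snd u"] by (auto simp: dg_def up_def)

lemma down_left_in_dg:
  "down x \<in> dg lam \<Longrightarrow> z \<in> dg lam \<Longrightarrow> fst z = fst x \<Longrightarrow> snd z < snd x \<Longrightarrow> down z \<in> dg lam"
  by (auto simp: dg_def down_def)

text \<open>As a result the arm sums in both statistics depend on the shape only.\<close>

lemma Des_CSF: "F \<in> CSF n lam \<Longrightarrow> Des lam F = {u \<in> dg lam. 1 < fst u}"
proof -
  assume F: "F \<in> CSF n lam"
  have "F (up u) < F u" if "u \<in> dg lam" "1 < fst u" for u
    using that CSF_column[OF F, of "fst u - 1" "snd u"] by (auto simp: dg_def up_def)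
  then show ?thesis by (auto simp: Des_def)
qed

text \<open>Each pair \<open>(z, x)\<close> of cells in a row is completed to the triple of \<open>z\<close>, \<open>x\<close> and the cell
  below \<open>x\<close>. With \<open>A\<close> and \<open>B\<close> the triples in which \<open>z\<close> attacks \<open>x\<close>, respectively \<open>down x\<close> attacks
  \<open>z\<close>, with an inversion, \<open>C\<close> those where \<open>down x\<close> exists, and \<open>Z\<close> those which \<open>zcount\<close> counts,
  column strictness gives \<open>A \<union> B = Z \<union> C\<close> and \<open>A \<inter> B = Z \<inter> C\<close>. The instances \<open>R = (<)\<close> and
  \<open>R = (>)\<close> describe \<open>Inv\<close> and \<open>Quinv\<close>.\<close>

lemma card_attacks:
  assumes F: "F \<in> CSF n lam"
  shows "card {(u, v) \<in> dg lam \<times> dg lam.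
      ((fst u = fst v \<and> R (snd u) (snd v)) \<or> (fst u = fst v + 1 \<and> R (snd v) (snd u))) \<and> F u > F v}
    = (\<Sum>z\<in>dg lam. card {x \<in> dg lam. fst x = fst z \<and> R (snd z) (snd x) \<and>
        F x < F z \<and> (down x \<notin> dg lam \<or> F z < F (down x))})
      + card {(z, x) \<in> dg lam \<times> dg lam. fst z = fst x \<and> R (snd z) (snd x) \<and> down x \<in> dg lam}"
    (is "card ?I = (\<Sum>z\<in>_. card (?z z)) + card ?C")
proof -
  define P where "P = {(z, x) \<in> dg lam \<times> dg lam. fst z = fst x \<and> R (snd z) (snd x)}"
  define A where "A = {(z, x) \<in> P. F z > F x}"
  define B where "B = {(z, x) \<in> P. down x \<in> dg lam \<and> F (down x) > F z}"
  define Z where "Z = {(z, x) \<in> P. F x < F z \<and> (down x \<notin> dg lam \<or> F z < F (down x))}"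
  define I2 where "I2 = {(u, v) \<in> dg lam \<times> dg lam. fst u = fst v + 1 \<and> R (snd v) (snd u) \<and> F u > F v}"
  have fP: "finite P"
    by (rule finite_subset[OF _ finite_cartesian_product[OF finite_dg finite_dg]]) (auto simp: P_def)
  have fin: "finite A" "finite B" "finite Z" "finite ?C" "finite I2"
    using fP by (auto simp: A_def B_def Z_def I2_def P_def
        intro: finite_subset[OF _ finite_cartesian_product[OF finite_dg finite_dg]])
  have C: "?C = {(z, x) \<in> P. down x \<in> dg lam}" by (auto simp: P_def)
  have down: "F x < F (down x)" if "x \<in> dg lam" "down x \<in> dg lam" for x
    using that CSF_column[OF F, of "fst x" "snd x"] by (auto simp: dg_def down_def)
  have "(z, x) \<in> A \<union> B \<longleftrightarrow> (z, x) \<in> Z \<union> ?C" "(z, x) \<in> A \<inter> B \<longleftrightarrow> (z, x) \<in> Z \<inter> ?C" for z x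
    unfolding A_def B_def Z_def C using down[of x] by (auto simp: P_def)
  from this[of "fst p" "snd p" for p]
  have AB: "p \<in> A \<union> B \<longleftrightarrow> p \<in> Z \<union> ?C" "p \<in> A \<inter> B \<longleftrightarrow> p \<in> Z \<inter> ?C" for p
    by (simp_all only: prod.collapse)
  have "A \<union> B = Z \<union> ?C" by (rule set_eqI) (rule AB(1))
  moreover have "A \<inter> B = Z \<inter> ?C" by (rule set_eqI) (rule AB(2))
  ultimately have "card A + card B = card Z + card ?C"
    using card_Un_Int[OF fin(1,2)] card_Un_Int[OF fin(3,4)] by simp
  moreover have "card B = card I2"
  proof (rule bij_betw_same_card[of "\<lambda>(z, x). (down x, z)"])
    show "bij_betw (\<lambda>(z, x). (down x, z)) B I2"
      by (rule bij_betw_byWitness[where f' = "\<lambda>(u, v). (v, up u)"])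
         (auto simp: B_def I2_def P_def up_in_dg dest: dg_row)
  qed
  moreover have "?I = A \<union> I2" "A \<inter> I2 = {}" by (auto simp: A_def I2_def P_def)
  then have "card ?I = card A + card I2" using fin by (simp add: card_Un_disjoint)
  moreover have "Z = Sigma (dg lam) ?z" by (auto simp: Z_def P_def)
  then have "card Z = (\<Sum>z\<in>dg lam. card (?z z))" using finite_dg by (simp add: card_SigmaI)
  ultimately show ?thesis by simp
qed

text \<open>Moving a pair \<open>(z, x)\<close> one row down puts \<open>down x\<close> into the arm
  of the descent \<open>down z\<close>, which exists because \<open>z\<close> lies left of
  \<open>x\<close>. So the arm sum cancels the last term of \<open>card_attacks\<close>.\<close>

lemma inv_stat_eq_sum_zcount_bar:
  assumes F: "F \<in> CSF n lam"
  shows "inv_stat lam F = int (\<Sum>u\<in>dg lam. zcount_bar lam u F)"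
proof -
  let ?C = "{(z, x) \<in> dg lam \<times> dg lam. fst z = fst x \<and> snd z < snd x \<and> down x \<in> dg lam}"
  let ?S = "Sigma (Des lam F) (\<lambda>u. {v \<in> dg lam. fst v = fst u \<and> snd v > snd u})"
  have "bij_betw (\<lambda>(z, x). (down z, down x)) ?C ?S"
    unfolding Des_CSF[OF F]
    by (rule bij_betw_byWitness[where f' = "\<lambda>(u, v). (up u, up v)"])
       (auto simp: up_in_dg down_left_in_dg dest: dg_row)
  then have "card ?C = card ?S" by (rule bij_betw_same_card)
  also have "\<dots> = (\<Sum>u\<in>Des lam F. arm lam u)"
    using finite_dg by (simp add: arm_def Des_def card_SigmaI)
  finally show ?thesis
    using card_attacks[OF F, of "(<)"]
    by (simp add: inv_stat_def Inv_def inv_attacks_def zcount_bar_def)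
qed

text \<open>Now \<open>x\<close> lies left of \<open>z\<close>, so \<open>down x\<close> is a
  descent and \<open>z\<close> lies in the arm of the cell above it; again the arm sum
  cancels.\<close>

lemma quinv_stat_eq_sum_zcount:
  assumes F: "F \<in> CSF n lam"
  shows "quinv_stat lam F = int (\<Sum>u\<in>dg lam. zcount lam u F)"
proof -
  let ?C = "{(z, x) \<in> dg lam \<times> dg lam. fst z = fst x \<and> snd z > snd x \<and> down x \<in> dg lam}"
  let ?S = "Sigma (Des lam F) (\<lambda>u. {v \<in> dg lam. fst v = fst (up u) \<and> snd v > snd (up u)})"
  have "bij_betw (\<lambda>(z, x). (down x, z)) ?C ?S"
    unfolding Des_CSF[OF F]
    by (rule bij_betw_byWitness[where f' = "\<lambda>(u, v). (v, up u)"])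
       (auto simp: up_in_dg down_left_in_dg dest: dg_row)
  then have "card ?C = card ?S" by (rule bij_betw_same_card)
  also have "\<dots> = (\<Sum>u\<in>Des lam F. arm lam (up u))"
    using finite_dg by (simp add: arm_def Des_def card_SigmaI)
  finally show ?thesis
    using card_attacks[OF F, of "(>)"]
    by (simp add: quinv_stat_def Quinv_def quinv_attacks_def zcount_def)
qed

section \<open>The statistics as total sizes of the partitions\<close>

lemma sum_dg_eq_sum_cells:
  fixes h :: "nat \<times> nat \<Rightarrow> nat"
  assumes F: "F \<in> CSF n lam" and h: "\<And>u. u \<in> dg lam \<Longrightarrow> F u = fst u \<Longrightarrow> h u = 0"
  shows "(\<Sum>u\<in>dg lam. h u) =
    (\<Sum>(i, j)\<in>{(i, j). 1 \<le> i \<and> i \<le> j \<and> j < n}. sum_list (map h (cells lam i j F)))"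
proof -
  let ?J = "{(i, j). 1 \<le> i \<and> i \<le> j \<and> j < n}" and ?D = "{u \<in> dg lam. fst u < F u}"
  \<comment> \<open>A cell in row \<open>i\<close> with entry \<open>j + 1\<close> belongs to the
    box \<open>(i, j)\<close>. Cells whose entry is their row index belong to no box, hence the
    assumption on \<open>h\<close>.\<close>
  let ?g = "\<lambda>u. (fst u, F u - 1)"
  have range: "fst u \<le> F u" "F u \<le> n" "1 \<le> fst u" if "u \<in> dg lam" for u
    using CSF_ge_row[OF F, of "fst u" "snd u"] CSF_range[OF F, of "fst u" "snd u"] that
    by (auto simp: dg_def)
  have "?J \<subseteq> {..n} \<times> {..n}" by auto
  then have finJ: "finite ?J" by (rule finite_subset) auto
  have gD: "?g ` ?D \<subseteq> ?J" using range by fastforce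
  have "(\<Sum>u\<in>dg lam. h u) = (\<Sum>u\<in>?D. h u)"
  proof (rule sum.mono_neutral_right)
    show "\<forall>u\<in>dg lam - ?D. h u = 0"
      using h range(1) by (metis (no_types, lifting) DiffE le_neq_implies_less mem_Collect_eq)
  qed (use finite_dg in auto)
  also have "\<dots> = (\<Sum>p\<in>?J. \<Sum>u\<in>{u \<in> ?D. ?g u = p}. h u)"
    by (rule sum.group[OF _ finJ gD, symmetric]) (simp add: finite_dg)
  also have "\<dots> = (\<Sum>(i, j)\<in>?J. sum_list (map h (cells lam i j F)))"
  proof (rule sum.cong[OF refl])
    fix p assume p: "p \<in> ?J"
    obtain i j where ij: "p = (i, j)" by fastforce
    have "set (cells lam i j F) = {u \<in> ?D. ?g u = p}"
      using p ij by (auto simp: cells_eq dg_def)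
    moreover have "distinct (cells lam i j F)" by (simp add: cells_eq distinct_map inj_on_def)
    ultimately show "(\<Sum>u\<in>{u \<in> ?D. ?g u = p}. h u) = (case p of (i, j) \<Rightarrow> sum_list (map h (cells lam i j F)))"
      using ij by (simp add: sum_list_distinct_conv_sum_set)
  qed
  finally show ?thesis .
qed

text \<open>Each statistic becomes a function of the tuple of partitions alone, which is how
  \<open>Omega\<close> carries one to the other.\<close>

lemma stat_eq_sum_parts:
  assumes F: "F \<in> CSF n lam"
  shows "inv_stat lam F =
      int (\<Sum>(i, j)\<in>{(i, j). 1 \<le> i \<and> i \<le> j \<and> j < n}. sum_list (snd (psi_inv n lam F) (i, j)))"
    "quinv_stat lam F =
      int (\<Sum>(i, j)\<in>{(i, j). 1 \<le> i \<and> i \<le> j \<and> j < n}. sum_list (snd (psi_quinv n lam F) (i, j)))"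
proof -
  have ge: "fst x \<le> F x" if "x \<in> dg lam" for x
    using CSF_ge_row[OF F, of "fst x" "snd x"] that by (auto simp: dg_def)
  \<comment> \<open>An entry equal to its row index is minimal in its row, so nothing is
    counted.\<close>
  have empty: "{x \<in> dg lam. fst x = fst u \<and> P x \<and> F x < F u \<and> Q x} = {}" if "F u = fst u" for u P Q
  proof -
    have "\<not> F x < F u" if "x \<in> dg lam" "fst x = fst u" for x
      using ge[OF that(1)] that(2) \<open>F u = fst u\<close> by simp
    then show ?thesis by blast
  qed
  have z: "zcount_bar lam u F = 0" "zcount lam u F = 0" if "F u = fst u" for u
    unfolding zcount_bar_def zcount_def by (simp_all only: empty[OF that] card.empty)
  show "inv_stat lam F =
      int (\<Sum>(i, j)\<in>{(i, j). 1 \<le> i \<and> i \<le> j \<and> j < n}. sum_list (snd (psi_inv n lam F) (i, j)))"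
    unfolding inv_stat_eq_sum_zcount_bar[OF F]
    by (subst sum_dg_eq_sum_cells[OF F], use z(1) in \<open>simp\<close>,
      intro arg_cong[where f = int] sum.cong; auto simp: psi_apply)
  show "quinv_stat lam F =
      int (\<Sum>(i, j)\<in>{(i, j). 1 \<le> i \<and> i \<le> j \<and> j < n}. sum_list (snd (psi_quinv n lam F) (i, j)))"
    unfolding quinv_stat_eq_sum_zcount[OF F]
    by (subst sum_dg_eq_sum_cells[OF F], use z(2) in \<open>simp\<close>,
      intro arg_cong[where f = int] sum.cong; auto simp: psi_apply rev_map[symmetric] sum_list_rev)
qed

text \<open>A pattern records the row counts for \<open>i \<le> k \<le> n\<close> only; the others
  are forced, being \<open>0\<close> for \<open>k < i\<close> and the row length for
  \<open>k > n\<close>.\<close>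

lemma rsort_eqI:
  assumes F: "F \<in> CSF n lam" and G: "G \<in> CSF n lam"
    and eq: "pattern_of n lam (rsort lam F) = pattern_of n lam (rsort lam G)"
  shows "rsort lam F = rsort lam G"
proof -
  have "sort (row_entries lam F i) = sort (row_entries lam G i)" if i: "1 \<le> i" for i
  proof (rule sort_eq_if_counts_le_eq)
    fix k
    have full: "row_count lam H i k = lam i" if "H \<in> CSF n lam" "n \<le> k" for H
    proof -
      have "{c \<in> {1..lam i}. H (i, c) \<le> k} = {1..lam i}"
        using CSF_range[OF that(1) i] that(2) by fastforce
      then show ?thesis by (simp add: row_count_def)
    qed
    consider "k < i" | "n < k" | "i \<le> k" "k \<le> n" by linarith
    then have "row_count lam F i k = row_count lam G i k"
    proof cases
      case 1
      then show ?thesis using row_count_zero[OF F i] row_count_zero[OF G i] by simp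
    next
      case 2
      then show ?thesis using full F G by simp
    next
      case 3
      then show ?thesis using pattern_of_rsort[OF i] eq by (metis of_nat_eq_iff)
    qed
    then show "length (filter (\<lambda>x. x \<le> k) (row_entries lam F i)) = length (filter (\<lambda>x. x \<le> k) (row_entries lam G i))"
      by (simp add: row_count_filter)
  qed
  then show ?thesis by (auto simp: rsort_def dg_def fun_eq_iff restrict_def)
qed

end

theorem corollary5:
  fixes n :: nat and lam :: "nat \<Rightarrow> nat"
  assumes "n \<ge> 1"
    and "\<And>r. r \<ge> 1 \<Longrightarrow> lam (Suc r) \<le> lam r"
    and "\<And>r. r > n \<Longrightarrow> lam r = 0"
  shows "bij_betw (psi_inv n lam) (CSF n lam) (POP n lam) \<and>
    bij_betw (psi_quinv n lam) (CSF n lam) (POP n lam) \<and>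
    (\<forall>F\<in>CSF n lam. Omega n lam F =
       (inv_into (CSF n lam) (psi_inv n lam) \<circ> boxcomp n \<circ> psi_inv n lam) F) \<and>
    (\<forall>F\<in>CSF n lam. Omega n lam F \<in> CSF n lam) \<and>
    (\<forall>F\<in>CSF n lam. Omega n lam (Omega n lam F) = F) \<and>
    (\<forall>F\<in>CSF n lam. inv_stat lam (Omega n lam F) = quinv_stat lam F) \<and>
    (\<forall>F\<in>CSF n lam. rsort lam F = rsort lam (Omega n lam F))"
proof -
  interpret partition_at_most n lam using assms(2,3) by unfold_locales
  let ?C = "CSF n lam" and ?psi = "psi_inv n lam" and ?Om = "Omega n lam"
  have quinv: "psi_quinv n lam F = boxcomp n (?psi F)" if "F \<in> ?C" for F
    using psi_quinv_eq_boxcomp[OF that] .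
  \<comment> \<open>Both maps have image \<open>POP n lam\<close>, so \<open>inv_into\<close> yields
    a true preimage.\<close>
  have img: "psi_quinv n lam F \<in> ?psi ` ?C" if "F \<in> ?C" for F
    using bij_psi_inv bij_psi_quinv that by (auto simp: bij_betw_def)
  have Om: "?Om F \<in> ?C" "?psi (?Om F) = psi_quinv n lam F" if "F \<in> ?C" for F
    using inv_into_into[OF img[OF that]] f_inv_into_f[OF img[OF that]] by (auto simp: Omega_def)
  have "?Om (?Om F) = F" if F: "F \<in> ?C" for F
  proof -
    \<comment> \<open>Seen through \<open>psi_inv\<close>, each application of \<open>Omega\<close>
      is a complementation.\<close>
    have "?psi (?Om (?Om F)) = boxcomp n (boxcomp n (?psi F))"
      using Om F quinv by simp
    also have "\<dots> = ?psi F" using boxcomp_in_POP(2) psi_inv_in_POP[OF F] by blast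
    finally show ?thesis using psi_inv_inj Om F by (meson inj_onD)
  qed
  moreover have "inv_stat lam (?Om F) = quinv_stat lam F" if F: "F \<in> ?C" for F
    using stat_eq_sum_parts(1)[OF Om(1)[OF F]] stat_eq_sum_parts(2)[OF F] Om(2)[OF F] by simp
  moreover have "rsort lam F = rsort lam (?Om F)" if F: "F \<in> ?C" for F
  proof (rule rsort_eqI[OF F Om(1)[OF F]])
    show "pattern_of n lam (rsort lam F) = pattern_of n lam (rsort lam (?Om F))"
      using Om(2)[OF F] by (simp add: psi_inv_def psi_quinv_def)
  qed
  moreover have "?Om F = (inv_into ?C ?psi \<circ> boxcomp n \<circ> ?psi) F" if "F \<in> ?C" for F
    by (simp add: Omega_def quinv[OF that])
  ultimately show ?thesis using bij_psi_inv bij_psi_quinv Om(1) by blast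
qed

end
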